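(* Let $2\leq p<\infty$ and $2\leq q<\infty$. Then $$\frac{\pi_{p,q}^2-x^2}{\pi_{p,q}^2+x^2}\leq\frac{\sin_{p,q}{x}}{x}\quad\text{for all } x\in\mathbb{R},\ x\neq 0.$$ In particular, for $2\leq p<\infty$, $$\frac{\pi_{p}^2-x^2}{\pi_{p}^2+x^2}\leq\frac{\sin_{p}{x}}{x}\quad\text{for all } x\in\mathbb{R},\ x\neq 0,$$ where $\sin_p{x}:=\sin_{p,p}{x}$ and $\pi_p:=\pi_{p,p}$.
   Context: For $1<p,q<\infty$ define $F_{p,q}(x):=\int_0^x \frac{dt}{(1-t^q)^{1/p}}$ for $x\in[0,1]$, and $\pi_{p,q}:=2F_{p,q}(1)=2\int_0^1\frac{dt}{(1-t^q)^{1/p}}$, which is finite. The function $\sin_{p,q}:[0,\pi_{p,q}/2]\to[0,1]$ is the inverse function of the increasing bijection $F_{p,q}:[0,1]\to[0,\pi_{p,q}/2]$. It is extended to $(\pi_{p,q}/2,\pi_{p,q}]$ by $\sin_{p,q}{x}:=\sin_{p,q}(\pi_{p,q}-x)$, and then to all of $\mathbb{R}$ as the odd, $2\pi_{p,q}$-periodic continuation. *)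

theory Defs
  imports "HOL-Analysis.Analysis"
begin

(* The integrand is singular at t = 1, where division by zero makes its value 0;
   this does not affect the integral. *)
definition F_pq :: "real \<Rightarrow> real \<Rightarrow> real \<Rightarrow> real" where
  "F_pq p q x = integral {0..x} (\<lambda>t. 1 / (1 - t powr q) powr (1 / p))"

definition pi_pq :: "real \<Rightarrow> real \<Rightarrow> real" where
  "pi_pq p q = 2 * F_pq p q 1"

(* The generalized sine on [0, pi_pq]; arguments outside this interval are not meaningful. *)
definition sin_pq_half :: "real \<Rightarrow> real \<Rightarrow> real \<Rightarrow> real" where
  "sin_pq_half p q x =
     (if x \<le> pi_pq p q / 2 then inv_into {0..1} (F_pq p q) x
      else inv_into {0..1} (F_pq p q) (pi_pq p q - x))"

(* Odd continuation to [-pi_pq, pi_pq]. *)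
definition sin_pq_base :: "real \<Rightarrow> real \<Rightarrow> real \<Rightarrow> real" where
  "sin_pq_base p q x = (if 0 \<le> x then sin_pq_half p q x else - sin_pq_half p q (- x))"

(* Periodic continuation: the argument is first translated by a multiple of the period
   2 * pi_pq into [-pi_pq, pi_pq). *)
definition sin_pq :: "real \<Rightarrow> real \<Rightarrow> real \<Rightarrow> real" where
  "sin_pq p q x =
     sin_pq_base p q (x - 2 * pi_pq p q * of_int \<lfloor>(x + pi_pq p q) / (2 * pi_pq p q)\<rfloor>)"

definition pi_p :: "real \<Rightarrow> real" where
  "pi_p p = pi_pq p p"

definition sin_p :: "real \<Rightarrow> real \<Rightarrow> real" where
  "sin_p p x = sin_pq p p x"

end

theory Submission
  imports Defs
begin

text \<open>
  The general inequality follows from the classical one for the sine by comparison.  Write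
  \<open>P\<close> for \<open>pi_pq p q\<close> and \<open>R P x\<close> for \<open>x * (P\<^sup>2 - x\<^sup>2) / (P\<^sup>2 + x\<^sup>2)\<close>, the lower bound for
  \<open>sin_pq p q x\<close> claimed for positive \<open>x\<close>.

  For \<open>p, q \<ge> 2\<close> the integrand of \<open>F_pq\<close> lies between \<open>1\<close> and \<open>1 / sqrt (1 - t\<^sup>2)\<close>, so
  \<open>F_pq\<close> lies between the identity and the arc sine (\<open>F_pq_increment_bounds\<close>).  Three things
  follow: \<open>2 \<le> P \<le> pi\<close>; \<open>sin_pq p q x \<le> x\<close> for \<open>x \<ge> 0\<close>; and \<open>sin x \<le> sin_pq p q x\<close> on \<open>[0, P/2]\<close>.

  For fixed \<open>x \<ge> 0\<close> the bound \<open>R P x\<close> increases with \<open>P\<close>.  Hence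
  \<open>R P x \<le> R pi x \<le> sin x \<le> sin_pq p q x\<close> on \<open>[0, P/2]\<close>, where the second inequality is
  Redheffer's (\<open>redheffer_le_sin\<close>).

  On \<open>[P/2, P]\<close> the generalized sine is reflected about \<open>P/2\<close>, and \<open>R P\<close> does not exceed its own
  reflection there (\<open>redheffer_reflect\<close>), so the bound carries over from \<open>[0, P/2]\<close>.  On
  \<open>[P, 2 * P]\<close> one has \<open>R P x \<le> P - x \<le> - sin_pq p q (x - P) = sin_pq p q x\<close>, and further
  out \<open>P - x\<close> is already below \<open>-1\<close>.  Negative arguments are covered by parity.
\<close>

section \<open>The Redheffer bound\<close>

definition redheffer :: "real \<Rightarrow> real \<Rightarrow> real" where
  "redheffer P x = x * (P\<^sup>2 - x\<^sup>2) / (P\<^sup>2 + x\<^sup>2)"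

lemma redheffer_mono:
  assumes "0 < P" "P \<le> Q" "0 \<le> x"
  shows "redheffer P x \<le> redheffer Q x"
proof -
  have sq: "P\<^sup>2 \<le> Q\<^sup>2"
    using assms by (intro power_mono) auto
  have pos: "P\<^sup>2 + x\<^sup>2 > 0" "Q\<^sup>2 + x\<^sup>2 > 0"
    using assms by (auto intro: add_pos_nonneg)
  have "0 \<le> x ^ 3 * (Q\<^sup>2 - P\<^sup>2)"
    using assms sq by (intro mult_nonneg_nonneg) auto
  then have "x * (P\<^sup>2 - x\<^sup>2) * (Q\<^sup>2 + x\<^sup>2) \<le> x * (Q\<^sup>2 - x\<^sup>2) * (P\<^sup>2 + x\<^sup>2)"
    by (simp add: algebra_simps power2_eq_square power3_eq_cube)
  then show ?thesis
    unfolding redheffer_def using pos by (simp add: divide_simps)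
qed

text \<open>With \<open>P = x + y\<close> the cross-multiplied difference of the two sides factors as
  \<open>x\<^sup>2 * y\<^sup>2 * (x - y)\<close>.\<close>

lemma redheffer_reflect:
  assumes "0 < P" "P / 2 \<le> x" "x \<le> P"
  shows "redheffer P x \<le> redheffer P (P - x)"
proof -
  define y where "y = P - x"
  have P: "P = x + y" and xy: "0 \<le> y" "y \<le> x"
    using assms by (auto simp: y_def)
  have pos: "P\<^sup>2 + x\<^sup>2 > 0" "P\<^sup>2 + y\<^sup>2 > 0"
    using assms by (auto intro: add_pos_nonneg)
  have "y * (P\<^sup>2 - y\<^sup>2) * (P\<^sup>2 + x\<^sup>2) - x * (P\<^sup>2 - x\<^sup>2) * (P\<^sup>2 + y\<^sup>2) = x\<^sup>2 * y\<^sup>2 * (x - y)"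
    unfolding P by algebra
  moreover have "0 \<le> x\<^sup>2 * y\<^sup>2 * (x - y)"
    using xy by simp
  ultimately have "x * (P\<^sup>2 - x\<^sup>2) * (P\<^sup>2 + y\<^sup>2) \<le> y * (P\<^sup>2 - y\<^sup>2) * (P\<^sup>2 + x\<^sup>2)"
    by linarith
  then show ?thesis
    unfolding redheffer_def y_def[symmetric] using pos by (simp add: divide_simps)
qed

text \<open>The factor \<open>x - P\<close> of \<open>- redheffer P x\<close> is multiplied by \<open>x * (x + P) / (P\<^sup>2 + x\<^sup>2)\<close>,
  which is at least \<open>1\<close> as soon as \<open>x \<ge> P\<close>.\<close>

lemma redheffer_le_beyond:
  assumes "0 < P" "P \<le> x"
  shows "redheffer P x \<le> P - x"
proof -
  have pos: "P\<^sup>2 + x\<^sup>2 > 0"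
    using assms by (auto intro: add_pos_nonneg)
  have "0 \<le> (x - P) * (P * (x - P))"
    using assms by (intro mult_nonneg_nonneg) auto
  also have "\<dots> = (P - x) * (P\<^sup>2 + x\<^sup>2) - x * (P\<^sup>2 - x\<^sup>2)"
    by algebra
  finally show ?thesis
    unfolding redheffer_def using pos by (simp add: pos_divide_le_eq)
qed

section \<open>Redheffer's inequality for the sine\<close>

lemma sin_ge_cubic:
  fixes x :: real
  assumes "0 \<le> x"
  shows "x - x ^ 3 / 6 \<le> sin x"
proof (cases "x = 0")
  case False
  with assms have "x > 0" by simp
  then obtain t where
    t: "sin x = (\<Sum>m<3. sin_coeff m * x ^ m) + (sin (t + 1/2 * real 3 * pi) / fact 3) * x ^ 3"
    using Maclaurin_sin_expansion3[of 3 x] by auto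
  have "sin (t + 1/2 * real 3 * pi) * x ^ 3 \<ge> (-1) * x ^ 3"
    by (rule mult_right_mono) (use \<open>x > 0\<close> in auto)
  then show ?thesis
    unfolding t by (simp add: sin_coeff_def eval_nat_numeral field_simps)
qed simp

lemma cos_ge_quadratic:
  fixes x :: real
  shows "1 - x\<^sup>2 / 2 \<le> cos x"
proof -
  have "(sin (x/2))\<^sup>2 \<le> (x/2)\<^sup>2"
    using abs_sin_x_le_abs_x[of "x/2"] abs_le_square_iff by blast
  then show ?thesis
    using cos_double_sin[of "x/2"] by (simp add: power2_eq_square)
qed

text \<open>The cubic Taylor bound of the sine exceeds the Redheffer bound exactly as long as
  \<open>pi\<^sup>2 + x\<^sup>2 \<le> 12\<close>, which includes \<open>x \<le> 1.4\<close>.  The remaining \<open>x\<close> are so close to \<open>pi / 2\<close>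
  that the sine is at least \<open>0.98\<close>, whereas the Redheffer bound never reaches \<open>0.95\<close>.\<close>

lemma redheffer_le_sin:
  assumes "0 \<le> x" "x \<le> pi / 2"
  shows "redheffer pi x \<le> sin x"
proof -
  have pi: "3.14 \<le> pi" "pi \<le> 3.15"
    using pi_approx by auto
  have pi_sq: "9.8 \<le> pi\<^sup>2" "pi\<^sup>2 \<le> 9.9"
    using power_mono[of "3.14" pi 2] power_mono[of pi "3.1416" 2] pi_approx
    by (auto simp: power2_eq_square)
  have pos: "pi\<^sup>2 + x\<^sup>2 > 0"
    by (intro add_pos_nonneg) auto
  show ?thesis
  proof (cases "x \<le> 1.4")
    case True
    then have "x\<^sup>2 \<le> 1.96"
      using power_mono[of x "1.4" 2] assms by (simp add: power2_eq_square)
    then have "0 \<le> x ^ 3 / 6 * (12 - (pi\<^sup>2 + x\<^sup>2))"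
      using pi_sq assms by (intro mult_nonneg_nonneg) auto
    then have "x * (pi\<^sup>2 - x\<^sup>2) \<le> (x - x ^ 3 / 6) * (pi\<^sup>2 + x\<^sup>2)"
      by (simp add: algebra_simps power2_eq_square power3_eq_cube)
    then have "redheffer pi x \<le> x - x ^ 3 / 6"
      unfolding redheffer_def using pos by (simp add: pos_divide_le_eq)
    then show ?thesis
      using sin_ge_cubic[OF assms(1)] by linarith
  next
    case False
    have "(pi / 2 - x)\<^sup>2 \<le> 0.2\<^sup>2"
      using False assms pi by (intro power_mono) auto
    then have "(pi / 2 - x)\<^sup>2 \<le> 0.04"
      by (simp add: power_divide)
    then have "0.98 \<le> cos (pi / 2 - x)"
      using cos_ge_quadratic[of "pi / 2 - x"] by simp
    then have s: "0.98 \<le> sin x"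
      by (simp add: sin_cos_eq)
    \<comment> \<open>Tangent lines at \<open>1.5\<close>, a point near the maximum of the Redheffer bound, replace the
      powers of \<open>x\<close>.\<close>
    have "0 \<le> (x - 1.5)\<^sup>2" "0 \<le> (x - 1.5)\<^sup>2 * (x + 3)"
      using assms by auto
    then have tangent: "3 * x - 2.25 \<le> x\<^sup>2" "6.75 * x - 6.75 \<le> x ^ 3"
      by (simp_all add: field_simps power2_eq_square power3_eq_cube)
    have "x * (pi\<^sup>2 - 9.69) \<le> 1.6 * 0.21"
      using assms pi pi_sq by (intro mult_mono) auto
    then have "x * pi\<^sup>2 - x ^ 3 \<le> 0.98 * pi\<^sup>2 + 0.98 * x\<^sup>2"
      using tangent pi_sq by (simp add: right_diff_distrib)
    then have "x * (pi\<^sup>2 - x\<^sup>2) \<le> 0.98 * (pi\<^sup>2 + x\<^sup>2)"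
      by (simp add: algebra_simps power2_eq_square power3_eq_cube)
    then have "redheffer pi x \<le> 0.98"
      unfolding redheffer_def using pos by (simp add: pos_divide_le_eq)
    with s show ?thesis by linarith
  qed
qed

section \<open>Comparison with the arc sine\<close>

lemma F_pq_0: "F_pq p q 0 = 0"
  by (simp add: F_pq_def)

lemma has_integral_arcsin:
  fixes x y :: real
  assumes "0 \<le> x" "x \<le> y" "y \<le> 1"
  shows "((\<lambda>t. inverse (sqrt (1 - t\<^sup>2))) has_integral (arcsin y - arcsin x)) {x..y}"
proof (rule fundamental_theorem_of_calculus_interior)
  show "continuous_on {x..y} arcsin"
    using assms by (intro continuous_on_subset[OF continuous_on_arcsin']) auto
  show "(arcsin has_vector_derivative inverse (sqrt (1 - t\<^sup>2))) (at t)" if "t \<in> {x<..<y}" for t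
    using that assms DERIV_arcsin[of t]
    by (auto simp: has_real_derivative_iff_has_vector_derivative)
qed (use assms in auto)

context
  fixes p q :: real
  assumes p: "2 \<le> p" and q: "2 \<le> q"
begin

text \<open>The upper bound holds because \<open>1 - t powr q\<close> and \<open>1 - t\<^sup>2\<close> lie in the unit interval: raising
  \<open>q\<close> above \<open>2\<close> increases the base, and lowering the exponent from \<open>1 / 2\<close> to \<open>1 / p\<close>
  increases the power.\<close>

lemma integrand_bounds:
  fixes t :: real
  assumes "0 \<le> t" "t < 1"
  shows "1 \<le> 1 / (1 - t powr q) powr (1 / p)"
    and "1 / (1 - t powr q) powr (1 / p) \<le> inverse (sqrt (1 - t\<^sup>2))"
proof -
  have t2: "0 < 1 - t\<^sup>2"
    using assms by (simp add: power_less_one_iff abs_square_less_1)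
  have tq: "t powr q \<le> t\<^sup>2"
    using powr_mono'[of 2 q t] q assms by simp
  have pos: "0 < (1 - t powr q) powr (1 / p)"
    using t2 tq by simp
  have "(1 - t powr q) powr (1 / p) \<le> 1 powr (1 / p)"
    using t2 tq p by (intro powr_mono2) auto
  with pos show "1 \<le> 1 / (1 - t powr q) powr (1 / p)"
    by simp
  have "(1 - t\<^sup>2) powr (1 / 2) \<le> (1 - t powr q) powr (1 / p)"
    using p t2 tq by (intro powr_mono_both') (auto simp: field_simps)
  then have "sqrt (1 - t\<^sup>2) \<le> (1 - t powr q) powr (1 / p)"
    using t2 by (simp add: powr_half_sqrt)
  then show "1 / (1 - t powr q) powr (1 / p) \<le> inverse (sqrt (1 - t\<^sup>2))"
    using t2 by (simp add: divide_inverse le_imp_inverse_le)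
qed

lemma integrand_integrable:
  "(\<lambda>t. 1 / (1 - t powr q) powr (1 / p)) integrable_on {0..1}"
proof (rule measurable_bounded_by_integrable_imp_integrable_real)
  have "(\<lambda>t::real. 1 / (1 - t powr q) powr (1 / p)) \<in> borel_measurable borel"
    by measurable
  then show "(\<lambda>t. 1 / (1 - t powr q) powr (1 / p)) \<in> borel_measurable (lebesgue_on {0..1})"
    by (intro measurable_restrict_space1 measurable_completion) simp
  show "(\<lambda>t::real. inverse (sqrt (1 - t\<^sup>2))) integrable_on {0..1}"
    using has_integral_integrable[OF has_integral_arcsin[of 0 1]] by simp
  show "\<bar>1 / (1 - t powr q) powr (1 / p)\<bar> \<le> inverse (sqrt (1 - t\<^sup>2))" if "t \<in> {0..1}" for t
    using that integrand_bounds[of t] by (cases "t = 1") auto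
qed auto

text \<open>The integrand stays between \<open>1\<close> and the derivative of the arc sine, except at the single
  point \<open>1\<close>, where division by zero gives it the value \<open>0\<close>.\<close>

lemma F_pq_increment_bounds:
  assumes "0 \<le> x" "x \<le> y" "y \<le> 1"
  shows "y - x \<le> F_pq p q y - F_pq p q x"
    and "F_pq p q y - F_pq p q x \<le> arcsin y - arcsin x"
proof -
  let ?f = "\<lambda>t::real. 1 / (1 - t powr q) powr (1 / p)"
  have sub: "?f integrable_on {a..b}" if "0 \<le> a" "b \<le> 1" for a b
    using that by (intro integrable_on_subinterval[OF integrand_integrable]) auto
  have "F_pq p q x + integral {x..y} ?f = F_pq p q y"
    unfolding F_pq_def using assms by (intro Henstock_Kurzweil_Integration.integral_combine sub) auto
  moreover have "(?f has_integral integral {x..y} ?f) {x..y}"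
    using assms by (intro integrable_integral sub) auto
  ultimately have f: "(?f has_integral (F_pq p q y - F_pq p q x)) {x..y}"
    by (metis add_diff_cancel_left')
  have one: "((\<lambda>t::real. if t = 1 then 0 else 1) has_integral (y - x)) {x..y}"
    by (rule has_integral_spike_finite[of "{1}" _ _ "\<lambda>_. 1"])
       (use has_integral_const_real[of "1::real" x y] assms in auto)
  show "y - x \<le> F_pq p q y - F_pq p q x"
    by (rule has_integral_le[OF one f]) (use assms integrand_bounds(1) in auto)
  show "F_pq p q y - F_pq p q x \<le> arcsin y - arcsin x"
  proof (rule has_integral_le[OF f has_integral_arcsin[OF assms]])
    show "?f t \<le> inverse (sqrt (1 - t\<^sup>2))" if "t \<in> {x..y}" for t
      using that assms integrand_bounds(2)[of t] by (cases "t = 1") auto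
  qed
qed

lemma F_pq_inj: "inj_on (F_pq p q) {0..1}"
proof (rule inj_onI)
  fix x y assume xy: "x \<in> {0..1}" "y \<in> {0..1}" and eq: "F_pq p q x = F_pq p q y"
  show "x = y"
  proof (cases "x \<le> y")
    case True
    then show ?thesis using F_pq_increment_bounds(1)[of x y] xy by (simp add: eq)
  next
    case False
    then show ?thesis using F_pq_increment_bounds(1)[of y x] xy by (simp add: eq)
  qed
qed

lemma pi_pq_bounds: "2 \<le> pi_pq p q" "pi_pq p q \<le> pi"
  using F_pq_increment_bounds[of 0 1] by (auto simp: pi_pq_def F_pq_0)

section \<open>The generalized sine\<close>

lemma sin_pq_half_inverse:
  assumes "0 \<le> x" "x \<le> pi_pq p q / 2"
  obtains s where "0 \<le> s" "s \<le> 1" "F_pq p q s = x" "sin_pq_half p q x = s"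
proof -
  have "continuous_on {0..1} (F_pq p q)"
    unfolding F_pq_def by (rule indefinite_integral_continuous_1[OF integrand_integrable])
  moreover have "F_pq p q 0 \<le> x" "x \<le> F_pq p q 1"
    using assms by (auto simp: F_pq_0 pi_pq_def)
  ultimately obtain s where s: "0 \<le> s" "s \<le> 1" "F_pq p q s = x"
    using IVT'[of "F_pq p q" 0 x 1] by auto
  have "inv_into {0..1} (F_pq p q) (F_pq p q s) = s"
    using s F_pq_inj by (intro inv_into_f_f) auto
  then have "sin_pq_half p q x = s"
    using assms s by (simp add: sin_pq_half_def)
  with s show ?thesis by (rule that)
qed

lemma sin_pq_half_reflect: "sin_pq_half p q (pi_pq p q - x) = sin_pq_half p q x"
proof (cases "x = pi_pq p q / 2")
  case True
  then have "pi_pq p q - x = x" by simp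
  then show ?thesis by simp
next
  case False
  then consider "x < pi_pq p q / 2" | "x > pi_pq p q / 2"
    by linarith
  then show ?thesis
    by cases (simp_all add: sin_pq_half_def)
qed

lemma sin_pq_half_0: "sin_pq_half p q 0 = 0"
proof -
  have "0 \<le> pi_pq p q / 2"
    using pi_pq_bounds by simp
  then obtain s where s: "0 \<le> s" "s \<le> 1" "F_pq p q s = 0" "sin_pq_half p q 0 = s"
    using sin_pq_half_inverse[OF order_refl] by blast
  then show ?thesis
    using F_pq_increment_bounds(1)[of 0 s] by (simp add: F_pq_0)
qed

text \<open>Inverting functions reverses their order: \<open>F_pq\<close> lies below the arc sine.\<close>

lemma sin_le_sin_pq_half:
  assumes "0 \<le> x" "x \<le> pi_pq p q / 2"
  shows "sin x \<le> sin_pq_half p q x"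
proof -
  obtain s where s: "0 \<le> s" "s \<le> 1" "F_pq p q s = x" "sin_pq_half p q x = s"
    using sin_pq_half_inverse[OF assms] .
  have "x \<le> arcsin s"
    using F_pq_increment_bounds(2)[of 0 s] s by (simp add: F_pq_0)
  then have "sin x \<le> sin (arcsin s)"
    using assms s arcsin_ubound[of s] by (intro sin_monotone_2pi_le) auto
  with s show ?thesis by simp
qed

lemma sin_pq_half_upper:
  assumes "0 \<le> x" "x \<le> pi_pq p q"
  shows "sin_pq_half p q x \<le> 1" "sin_pq_half p q x \<le> x"
proof -
  have main: "sin_pq_half p q y \<le> 1 \<and> sin_pq_half p q y \<le> y"
    if y: "0 \<le> y" "y \<le> pi_pq p q / 2" for y
  proof -
    obtain s where s: "0 \<le> s" "s \<le> 1" "F_pq p q s = y" "sin_pq_half p q y = s"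
      using sin_pq_half_inverse[OF y] .
    then show ?thesis
      using F_pq_increment_bounds(1)[of 0 s] by (simp add: F_pq_0)
  qed
  show "sin_pq_half p q x \<le> 1" "sin_pq_half p q x \<le> x"
    using main[of x] main[of "pi_pq p q - x"] assms sin_pq_half_reflect[of x]
    by (cases "x \<le> pi_pq p q / 2"; auto)+
qed

lemma sin_pq_half_nonneg:
  assumes "0 \<le> x" "x \<le> pi_pq p q"
  shows "0 \<le> sin_pq_half p q x"
proof -
  have main: "0 \<le> sin_pq_half p q y" if "0 \<le> y" "y \<le> pi_pq p q / 2" for y
    by (rule sin_pq_half_inverse[OF that]) simp
  show ?thesis
    using main[of x] main[of "pi_pq p q - x"] assms sin_pq_half_reflect[of x]
    by (cases "x \<le> pi_pq p q / 2") auto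
qed

lemma redheffer_le_sin_pq_half:
  assumes "0 \<le> x" "x \<le> pi_pq p q"
  shows "redheffer (pi_pq p q) x \<le> sin_pq_half p q x"
proof -
  let ?P = "pi_pq p q"
  have P: "2 \<le> ?P" "?P \<le> pi"
    using pi_pq_bounds by auto
  have left: "redheffer ?P y \<le> sin_pq_half p q y" if "0 \<le> y" "y \<le> ?P / 2" for y
  proof -
    have "redheffer ?P y \<le> redheffer pi y"
      using P that by (intro redheffer_mono) auto
    also have "\<dots> \<le> sin y"
      using P that by (intro redheffer_le_sin) auto
    also have "\<dots> \<le> sin_pq_half p q y"
      using that by (rule sin_le_sin_pq_half)
    finally show ?thesis .
  qed
  show ?thesis
  proof (cases "x \<le> ?P / 2")
    case True
    then show ?thesis using left assms by simp
  next
    case False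
    have "redheffer ?P x \<le> redheffer ?P (?P - x)"
      using False assms P by (intro redheffer_reflect) auto
    also have "\<dots> \<le> sin_pq_half p q (?P - x)"
      using False assms by (intro left) auto
    finally show ?thesis
      by (simp add: sin_pq_half_reflect)
  qed
qed

text \<open>The reduction in \<open>sin_pq\<close> lands in a half-open interval.  Both ends of the closed interval
  may nevertheless be used as representatives, since the odd continuation vanishes at both.\<close>

lemma sin_pq_translate:
  assumes "\<bar>r\<bar> \<le> pi_pq p q"
  shows "sin_pq p q (r + 2 * pi_pq p q * of_int k) = sin_pq_base p q r"
proof -
  let ?P = "pi_pq p q"
  have P: "0 < ?P" using pi_pq_bounds by simp
  have quot: "(r + 2 * ?P * of_int k + ?P) / (2 * ?P) = (r + ?P) / (2 * ?P) + of_int k"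
    using P by (simp add: field_simps)
  show ?thesis
  proof (cases "r = ?P")
    case True
    then have "\<lfloor>(r + ?P) / (2 * ?P)\<rfloor> = 1"
      using P by simp
    then have "sin_pq p q (r + 2 * ?P * of_int k) = sin_pq_base p q (- ?P)"
      unfolding sin_pq_def quot using True by (simp add: algebra_simps)
    also have "\<dots> = sin_pq_base p q ?P"
      using P sin_pq_half_reflect[of 0] by (simp add: sin_pq_base_def sin_pq_half_0)
    finally show ?thesis using True by simp
  next
    case False
    then have "\<lfloor>(r + ?P) / (2 * ?P)\<rfloor> = 0"
      using P assms by (intro floor_unique) (auto simp: field_simps)
    then show ?thesis
      unfolding sin_pq_def quot by simp
  qed
qed

lemma sin_pq_reduction:
  obtains r k where "\<bar>r\<bar> \<le> pi_pq p q" "x = r + 2 * pi_pq p q * of_int k"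
proof -
  let ?P = "pi_pq p q"
  define k where "k = \<lfloor>(x + ?P) / (2 * ?P)\<rfloor>"
  have P: "0 < ?P" using pi_pq_bounds by simp
  have "of_int k \<le> (x + ?P) / (2 * ?P)" "(x + ?P) / (2 * ?P) < of_int k + 1"
    unfolding k_def by linarith+
  then have "\<bar>x - 2 * ?P * of_int k\<bar> \<le> ?P"
    using P by (simp add: field_simps abs_le_iff)
  then show ?thesis
    by (rule that[where k = k]) simp
qed

lemma sin_pq_base_minus: "sin_pq_base p q (- x) = - sin_pq_base p q x"
  by (auto simp: sin_pq_base_def sin_pq_half_0)

lemma sin_pq_minus: "sin_pq p q (- x) = - sin_pq p q x"
proof -
  obtain r k where r: "\<bar>r\<bar> \<le> pi_pq p q" and x: "x = r + 2 * pi_pq p q * of_int k"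
    using sin_pq_reduction .
  have "- x = - r + 2 * pi_pq p q * of_int (- k)"
    using x by simp
  then have "sin_pq p q (- x) = sin_pq_base p q (- r)"
    using sin_pq_translate[of "- r" "- k"] r by simp
  then show ?thesis
    using sin_pq_translate[OF r, of k] x by (simp add: sin_pq_base_minus)
qed

lemma sin_pq_ge_minus_one: "- 1 \<le> sin_pq p q x"
proof -
  obtain r k where r: "\<bar>r\<bar> \<le> pi_pq p q" and x: "x = r + 2 * pi_pq p q * of_int k"
    using sin_pq_reduction .
  have "- 1 \<le> sin_pq_base p q r"
    using r sin_pq_half_nonneg[of r] sin_pq_half_upper(1)[of "- r"]
    by (auto simp: sin_pq_base_def)
  then show ?thesis
    using sin_pq_translate[OF r] x by simp
qed

section \<open>The inequality\<close>

lemma redheffer_le_sin_pq: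
  assumes "0 \<le> x"
  shows "redheffer (pi_pq p q) x \<le> sin_pq p q x"
proof -
  let ?P = "pi_pq p q"
  have P: "2 \<le> ?P" using pi_pq_bounds by simp
  consider "x \<le> ?P" | "?P < x" "x \<le> 2 * ?P" | "2 * ?P < x"
    by linarith
  then show ?thesis
  proof cases
    case 1
    have "sin_pq p q x = sin_pq_half p q x"
      using sin_pq_translate[of x 0] 1 assms by (simp add: sin_pq_base_def)
    then show ?thesis
      using redheffer_le_sin_pq_half 1 assms by simp
  next
    case 2
    \<comment> \<open>Here \<open>x = - (2 * P - x) + 2 * P\<close>, and reflecting \<open>2 * P - x\<close> about \<open>P/2\<close> gives \<open>x - P\<close>.\<close>
    have "sin_pq p q x = sin_pq_base p q (- (2 * ?P - x))"
      using sin_pq_translate[of "x - 2 * ?P" 1] 2 by simp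
    also have "\<dots> = - sin_pq_half p q (2 * ?P - x)"
      using 2 by (subst sin_pq_base_minus) (simp add: sin_pq_base_def)
    also have "\<dots> = - sin_pq_half p q (x - ?P)"
      using sin_pq_half_reflect[of "x - ?P"] by (simp add: algebra_simps)
    finally have "?P - x \<le> sin_pq p q x"
      using sin_pq_half_upper(2)[of "x - ?P"] 2 by simp
    moreover have "redheffer ?P x \<le> ?P - x"
      using 2 P by (intro redheffer_le_beyond) auto
    ultimately show ?thesis by linarith
  next
    case 3
    then have "redheffer ?P x \<le> ?P - x"
      using P by (intro redheffer_le_beyond) auto
    also have "\<dots> \<le> - 1"
      using P 3 by simp
    finally show ?thesis
      using sin_pq_ge_minus_one[of x] by simp
  qed
qed

lemma sin_pq_over_x_bound:
  assumes "x \<noteq> 0"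
  shows "((pi_pq p q)\<^sup>2 - x\<^sup>2) / ((pi_pq p q)\<^sup>2 + x\<^sup>2) \<le> sin_pq p q x / x"
proof -
  have pos: "((pi_pq p q)\<^sup>2 - y\<^sup>2) / ((pi_pq p q)\<^sup>2 + y\<^sup>2) \<le> sin_pq p q y / y" if "0 < y" for y
    using redheffer_le_sin_pq[of y] that
    by (simp add: redheffer_def pos_le_divide_eq mult.commute)
  show ?thesis
  proof (cases "0 < x")
    case True
    then show ?thesis by (rule pos)
  next
    case False
    then show ?thesis
      using pos[of "- x"] assms by (simp add: sin_pq_minus)
  qed
qed

end

theorem theorem1p2:
  shows "(\<forall>p q x :: real. 2 \<le> p \<longrightarrow> 2 \<le> q \<longrightarrow> x \<noteq> 0 \<longrightarrow>
            ((pi_pq p q)\<^sup>2 - x\<^sup>2) / ((pi_pq p q)\<^sup>2 + x\<^sup>2) \<le> sin_pq p q x / x)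
       \<and> (\<forall>p x :: real. 2 \<le> p \<longrightarrow> x \<noteq> 0 \<longrightarrow>
            ((pi_p p)\<^sup>2 - x\<^sup>2) / ((pi_p p)\<^sup>2 + x\<^sup>2) \<le> sin_p p x / x)"
  by (simp add: sin_pq_over_x_bound pi_p_def sin_p_def)

end
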